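(* Let $n\in\mathbb{N}$, $d\in\mathbb{N}\cup\{\infty\}$, $a_1,\dots,a_n\in\mathbb{R}$, and let $s=(s_\alpha)_{\alpha\in\mathbb{N}_0^n,|\alpha|\le d}$ be a real sequence. The following are equivalent: (i) $s$ is a moment sequence. (ii) $\mathfrak{t}_s(t)$ is a moment sequence for some $t\in\mathbb{R}$. (iii) $\mathfrak{t}_s(t)$ is a moment sequence for all $t\in\mathbb{R}$. That is, for $s\in\mathcal{S}_d$ one has $\mathfrak{I}_s=\mathbb{R}$ and $\mathfrak{T}_s=\mathfrak{t}_s(\mathbb{R})$.
   Context: $\mathcal{S}_d$ denotes the set of all moment sequences, i.e. real sequences $s=(s_\alpha)_{\alpha\in\mathbb{N}_0^n,|\alpha|\le d}$ (no restriction on $|\alpha|$ if $d=\infty$) for which there is a positive Borel measure $\mu$ on $\mathbb{R}^n$ such that $x^\alpha$ is $\mu$-integrable and $s_\alpha=\int_{\mathbb{R}^n}x^\alpha\,d\mu(x)$ for all $|\alpha|\le d$. For $t\in\mathbb{R}$, $\mathfrak{t}_s(t)=(\mathfrak{t}_{s,\alpha}(t))_{|\alpha|\le d}$ is defined by $$\mathfrak{t}_{s,\alpha}(t):=s_\alpha\exp\Big(-\sum_{i=1}^na_i(\alpha_i+1)t\Big)$$ (evolution of moments under the transport equation $\partial_tu=\sum_ia_ix_i\partial_iu$). For $s\in\mathcal{S}_d$, $\mathfrak{I}_s:=\{t\in\mathbb{R}\mid\mathfrak{t}_s(t)\in\mathcal{S}_d\}$ and the transport curve is $\mathfrak{T}_s:=\mathfrak{t}_s(\mathfrak{I}_s)\subseteq\mathcal{S}_d$.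 *)

theory Defs
  imports "HOL-Analysis.Analysis"
begin

text \<open>
  The dimension is \<open>n = CARD('n)\<close>, and a multi-index of \<open>\<nat>\<^sub>0\<^sup>n\<close> is a function \<open>'n \<Rightarrow> nat\<close>.
  The degree bound \<open>d :: enat\<close> may be \<open>\<infinity>\<close>.
\<close>

definition multi_indices :: "enat \<Rightarrow> ('n::finite \<Rightarrow> nat) set" where
  "multi_indices d = {\<alpha>. enat (\<Sum>i\<in>UNIV. \<alpha> i) \<le> d}"

text \<open>
  A real family indexed by \<open>multi_indices d\<close> is represented by the unique extensional function
  (equal to \<open>undefined\<close> off the index set) with these values, so that equality of functions is
  equality of families.
\<close>

definition real_sequences :: "enat \<Rightarrow> (('n::finite \<Rightarrow> nat) \<Rightarrow> real) set" where
  "real_sequences d = multi_indices d \<rightarrow>\<^sub>E UNIV"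

definition monomial :: "('n::finite \<Rightarrow> nat) \<Rightarrow> real ^ 'n \<Rightarrow> real" where
  "monomial \<alpha> x = (\<Prod>i\<in>UNIV. (x $ i) ^ \<alpha> i)"

definition moment_sequences :: "enat \<Rightarrow> (('n::finite \<Rightarrow> nat) \<Rightarrow> real) set" where
  "moment_sequences d =
    {s \<in> real_sequences d. \<exists>\<mu> :: (real ^ 'n) measure. sets \<mu> = sets borel \<and>
       (\<forall>\<alpha>\<in>multi_indices d. integrable \<mu> (monomial \<alpha>) \<and> s \<alpha> = integral\<^sup>L \<mu> (monomial \<alpha>))}"

text \<open>
  The evolution of moments under \<open>\<partial>\<^sub>t u = (\<Sum>i. a\<^sub>i x\<^sub>i \<partial>\<^sub>i u)\<close>: the solution is
  \<open>u(x,t) = u\<^sub>0(e\<^bsup>a\<^sub>1t\<^esup>x\<^sub>1, \<dots>, e\<^bsup>a\<^sub>nt\<^esup>x\<^sub>n)\<close>, and substituting in \<open>\<integral> x\<^sup>\<alpha> u(x,t) dx\<close>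
  produces the exponential factor.
\<close>

definition transport_moments ::
    "enat \<Rightarrow> ('n::finite \<Rightarrow> real) \<Rightarrow> (('n \<Rightarrow> nat) \<Rightarrow> real) \<Rightarrow> real \<Rightarrow> (('n \<Rightarrow> nat) \<Rightarrow> real)" where
  "transport_moments d a s t =
    (\<lambda>\<alpha>\<in>multi_indices d. s \<alpha> * exp (- (\<Sum>i\<in>UNIV. a i * (real (\<alpha> i) + 1) * t)))"

definition transport_times ::
    "enat \<Rightarrow> ('n::finite \<Rightarrow> real) \<Rightarrow> (('n \<Rightarrow> nat) \<Rightarrow> real) \<Rightarrow> real set" where
  "transport_times d a s = {t. transport_moments d a s t \<in> moment_sequences d}"

definition transport_curve ::
    "enat \<Rightarrow> ('n::finite \<Rightarrow> real) \<Rightarrow> (('n \<Rightarrow> nat) \<Rightarrow> real) \<Rightarrow> (('n \<Rightarrow> nat) \<Rightarrow> real) set" where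
  "transport_curve d a s = transport_moments d a s ` transport_times d a s"

end

theory Submission
  imports Defs
begin

text \<open>
  The measure \<open>\<mu>\<close> representing \<open>s\<close> is transported along the flow: its image under the diagonal map
  \<open>x\<^sub>i \<mapsto> e\<^bsup>-a\<^sub>it\<^esup>x\<^sub>i\<close>, multiplied by the Jacobian constant \<open>e\<^bsup>-(a\<^sub>1+\<dots>+a\<^sub>n)t\<^esup>\<close>, represents
  \<open>\<tt>\<^sub>s(t)\<close>. Since running time \<open>t\<close> and then time \<open>-t\<close> gives \<open>s\<close> back, the converse
  implications follow as well.
\<close>

lemma borel_measurable_monomial [measurable]: "monomial \<alpha> \<in> borel_measurable borel"
  unfolding monomial_def by measurable

text \<open>Monomials are eigenfunctions of composition with a diagonal map, so passing to the image
  measure rescales each moment on its own and never mixes different multi-indices.\<close>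

lemma monomial_diagonal:
  "monomial \<alpha> (\<chi> i. c i * x $ i) = (\<Prod>i\<in>UNIV. c i ^ \<alpha> i) * monomial \<alpha> x"
  by (simp add: monomial_def power_mult_distrib prod.distrib)

lemma transport_moments_in_real_sequences: "transport_moments d a s t \<in> real_sequences d"
  by (simp add: transport_moments_def real_sequences_def)

text \<open>The summand 1 in \<open>real (\<alpha> i) + 1\<close> yields the Jacobian constant, the
  same for all \<alpha>; the summand \<open>real (\<alpha> i)\<close> yields the eigenvalue of the
  monomial under the diagonal map.\<close>

lemma exp_transport_factor:
  fixes a :: "'n::finite \<Rightarrow> real"
  shows "exp (- (\<Sum>i\<in>UNIV. a i * (real (\<alpha> i) + 1) * t)) =
    exp (- (\<Sum>i\<in>UNIV. a i * t)) * (\<Prod>i\<in>UNIV. exp (- (a i * t)) ^ \<alpha> i)"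
proof -
  have "(\<Prod>i\<in>UNIV. exp (- (a i * t)) ^ \<alpha> i) = exp (\<Sum>i\<in>UNIV. real (\<alpha> i) * - (a i * t))"
    by (simp only: exp_sum finite exp_of_nat_mult)
  moreover have "- (\<Sum>i\<in>UNIV. a i * (real (\<alpha> i) + 1) * t) =
      - (\<Sum>i\<in>UNIV. a i * t) + (\<Sum>i\<in>UNIV. real (\<alpha> i) * - (a i * t))"
    unfolding sum_negf [symmetric] sum.distrib [symmetric]
    by (rule sum.cong) (auto simp: algebra_simps)
  ultimately show ?thesis
    by (simp only: exp_add)
qed

lemma moment_sequences_transport:
  fixes s :: "('n::finite \<Rightarrow> nat) \<Rightarrow> real"
  assumes "s \<in> moment_sequences d"
  shows "transport_moments d a s t \<in> moment_sequences d"
proof -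
  obtain \<mu> :: "(real ^ 'n) measure" where [measurable_cong]: "sets \<mu> = sets borel"
    and \<mu>: "\<And>\<alpha>. \<alpha> \<in> multi_indices d \<Longrightarrow> integrable \<mu> (monomial \<alpha>)"
           "\<And>\<alpha>. \<alpha> \<in> multi_indices d \<Longrightarrow> s \<alpha> = integral\<^sup>L \<mu> (monomial \<alpha>)"
    using assms unfolding moment_sequences_def by blast
  define L :: "real ^ 'n \<Rightarrow> real ^ 'n" where "L = (\<lambda>x. \<chi> i. exp (- (a i * t)) * x $ i)"
  define c where "c = exp (- (\<Sum>i\<in>UNIV. a i * t))"
  define \<nu> where "\<nu> = density (distr \<mu> borel L) (\<lambda>_. ennreal c)"
  have "continuous_on UNIV L"
    unfolding L_def by (intro continuous_intros)
  then have [measurable]: "L \<in> borel_measurable borel"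
    by (rule borel_measurable_continuous_onI)
  \<comment> \<open>Since \<open>ennreal\<close> cuts negative reals off at 0, the rules for
    \<open>density\<close> with a real weight ask for a nonnegative one.\<close>
  have "c \<ge> 0"
    by (simp add: c_def)
  have "integrable \<nu> (monomial \<alpha>) \<and> transport_moments d a s t \<alpha> = integral\<^sup>L \<nu> (monomial \<alpha>)"
    if "\<alpha> \<in> multi_indices d" for \<alpha>
  proof -
    define m where "m = (\<Prod>i\<in>UNIV. exp (- (a i * t)) ^ \<alpha> i)"
    have L: "monomial \<alpha> (L x) = m * monomial \<alpha> x" for x
      unfolding L_def m_def by (rule monomial_diagonal)
    \<comment> \<open>Pulled back along \<open>L\<close>, the integrand becomes \<open>m\<close>
      times the monomial, whose integrability under \<mu> is known.\<close>
    have "integrable (distr \<mu> borel L) (monomial \<alpha>)"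
      using \<mu>(1)[OF that] by (simp add: integrable_distr_eq L)
    then have "integrable \<nu> (monomial \<alpha>)"
      using \<open>c \<ge> 0\<close> by (simp add: \<nu>_def integrable_density)
    moreover have "integral\<^sup>L \<nu> (monomial \<alpha>) = c * (m * s \<alpha>)"
      using \<open>c \<ge> 0\<close> \<mu>[OF that] by (simp add: \<nu>_def integral_density integral_distr L)
    moreover have "transport_moments d a s t \<alpha> = s \<alpha> * (c * m)"
      using that by (simp add: transport_moments_def exp_transport_factor c_def m_def)
    ultimately show ?thesis
      by simp
  qed
  moreover have "sets \<nu> = sets borel"
    by (simp add: \<nu>_def)
  ultimately show ?thesis
    unfolding moment_sequences_def using transport_moments_in_real_sequences by blast
qed

text \<open>The exponent is linear in the time, so the factors for \<open>t\<close> and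
  \<open>- t\<close> cancel.\<close>

lemma transport_moments_inverse:
  assumes "s \<in> real_sequences d"
  shows "transport_moments d a (transport_moments d a s t) (- t) = s"
proof
  fix \<alpha>
  have "exp (- (\<Sum>i\<in>UNIV. a i * (real (\<alpha> i) + 1) * t)) *
      exp (- (\<Sum>i\<in>UNIV. a i * (real (\<alpha> i) + 1) * - t)) = 1"
    by (simp only: mult_minus_right sum_negf exp_add [symmetric] right_minus exp_zero)
  \<comment> \<open>Off the index set both sides are \<open>undefined\<close>: the left by
    \<open>restrict\<close>, the right because \<open>s\<close> is extensional.\<close>
  moreover have "s \<alpha> = undefined" if "\<alpha> \<notin> multi_indices d"
    using assms that unfolding real_sequences_def by (rule PiE_arb)
  ultimately show "transport_moments d a (transport_moments d a s t) (- t) \<alpha> = s \<alpha>"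
    by (simp only: transport_moments_def restrict_apply mult.assoc mult_1_right split: if_split)
      metis
qed

theorem corollary3p5:
  fixes d :: enat and a :: "'n::finite \<Rightarrow> real" and s :: "('n \<Rightarrow> nat) \<Rightarrow> real"
  assumes "s \<in> real_sequences d"
  shows "(s \<in> moment_sequences d \<longleftrightarrow>
            (\<exists>t::real. transport_moments d a s t \<in> moment_sequences d)) \<and>
         (s \<in> moment_sequences d \<longleftrightarrow>
            (\<forall>t::real. transport_moments d a s t \<in> moment_sequences d)) \<and>
         (s \<in> moment_sequences d \<longrightarrow>
            transport_times d a s = (UNIV :: real set) \<and>
            transport_curve d a s = transport_moments d a s ` (UNIV :: real set))"
proof -
  \<comment> \<open>A single good time suffices: flowing back by \<open>- t\<close> recovers
    \<open>s\<close>.\<close>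
  have "s \<in> moment_sequences d" if "transport_moments d a s t \<in> moment_sequences d" for t
    using moment_sequences_transport[OF that, of a "- t"] transport_moments_inverse[OF assms]
    by simp
  then show ?thesis
    unfolding transport_curve_def transport_times_def
    using moment_sequences_transport[of s d a] by auto
qed

end
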